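(* Let $g_0,\ldots,g_m,h_0,\ldots,h_m:\mathbb{R}^d\to\mathbb{R}$ be convex quadratic functions, and let $c\in\mathbb{R}^d$ be a feasible solution of the difference-of-convex problem $(\mathrm{DCO})$. Suppose that the set $$\underline{\Omega}(c):=\{z\in\mathbb{R}^d : \underline{g}_i(z;c)-h_i(z)\ge 0,\ i=1,2,\ldots,m\}$$ satisfies the Slater condition. If $c$ is an optimal solution of the restricted problem $(\mathrm{R}_c)$, then $c$ is a critical point of $(\mathrm{DCO})$.
   Context: The difference-of-convex optimization problem $(\mathrm{DCO})$ is: maximize $g_0(z)-h_0(z)$ over $z\in\mathbb{R}^d$ subject to $g_i(z)-h_i(z)\ge 0$ for all $1\le i\le m$, where $g_0,\ldots,g_m$ and $h_0,\ldots,h_m$ are convex quadratic functions on $\mathbb{R}^d$. For a fixed $c\in\mathbb{R}^d$, put $\underline{g}_i(z;c):=g_i(c)+\nabla g_i(c)^T(z-c)$ for $i=0,1,\ldots,m$ (the linearization of $g_i$ at $c$). The restricted problem $(\mathrm{R}_c)$ is: maximize $\underline{g}_0(z;c)-h_0(z)$ over $z\in\mathbb{R}^d$ subject to $\underline{g}_i(z;c)-h_i(z)\ge 0$ for all $1\le i\le m$. A feasible solution of a problem is a point satisfying all its constraints; an optimal solution is a feasible solution attaining the maximum of the objective over all feasible solutions. The Slater condition for $\underline{\Omega}(c)$ means that there exists $\bar z\in\mathbb{R}^d$ with $\underline{g}_i(\bar z;c)-h_i(\bar z)>0$ for all $i=1,\ldots,m$. A critical point of $(\mathrm{DCO})$ is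 a Karush–Kuhn–Tucker point, i.e. a point $c\in\mathbb{R}^d$ for which there exist scalars $\mu_1,\ldots,\mu_m$ such that $$\nabla g_0(c)+\sum_{i=1}^m\mu_i\nabla g_i(c)=\nabla h_0(c)+\sum_{i=1}^m\mu_i\nabla h_i(c),$$ and, for all $i=1,\ldots,m$, $g_i(c)\ge h_i(c)$, $\mu_i\ge 0$, and $\mu_i g_i(c)=\mu_i h_i(c)$. *)

theory Defs
  imports "HOL-Analysis.Analysis"
begin

text \<open>Affine functions are included as the degenerate case \<open>A = 0\<close>.  Requiring \<open>A\<close> to be
  symmetric costs no generality.\<close>

definition quadratic_function :: "(real ^ 'd \<Rightarrow> real) \<Rightarrow> bool" where
  "quadratic_function f \<longleftrightarrow>
     (\<exists>(A :: real ^ 'd ^ 'd) b r. transpose A = A \<and> (\<forall>z. f z = z \<bullet> (A *v z) + b \<bullet> z + r))"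

definition convex_quadratic :: "(real ^ 'd \<Rightarrow> real) \<Rightarrow> bool" where
  "convex_quadratic f \<longleftrightarrow> quadratic_function f \<and> convex_on UNIV f"

text \<open>The gradient is meaningful only where the function is differentiable; this holds everywhere
  for quadratic functions.\<close>

definition gradient :: "(real ^ 'd \<Rightarrow> real) \<Rightarrow> real ^ 'd \<Rightarrow> real ^ 'd" where
  "gradient f x = (THE D. GDERIV f x :> D)"

lemma gradient_eqI:
  assumes "GDERIV f x :> D"
  shows "gradient f x = D"
  unfolding gradient_def
proof (rule the_equality)
  show "GDERIV f x :> D" by (rule assms)
next
  fix E assume E: "GDERIV f x :> E"
  have "(\<lambda>h. h \<bullet> E) = (\<lambda>h. h \<bullet> D)"
    by (rule has_derivative_unique[OF E[unfolded gderiv_def] assms[unfolded gderiv_def]])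
  then have "(E - D) \<bullet> E = (E - D) \<bullet> D"
    by (rule fun_cong)
  then have "(E - D) \<bullet> (E - D) = 0"
    by (simp add: inner_diff_right)
  then show "E = D"
    by simp
qed

definition linearization :: "(real ^ 'd \<Rightarrow> real) \<Rightarrow> real ^ 'd \<Rightarrow> real ^ 'd \<Rightarrow> real" where
  "linearization f c z = f c + gradient f c \<bullet> (z - c)"

text \<open>In the following, the functions \<open>g i\<close> and \<open>h i\<close> are relevant for \<open>0 \<le> i \<le> m\<close>: index \<open>0\<close>
  is the objective, the indices \<open>1, \<dots>, m\<close> are the constraints.\<close>

definition dco_feasible ::
  "nat \<Rightarrow> (nat \<Rightarrow> real ^ 'd \<Rightarrow> real) \<Rightarrow> (nat \<Rightarrow> real ^ 'd \<Rightarrow> real) \<Rightarrow> (real ^ 'd) set" where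
  "dco_feasible m g h = {z. \<forall>i\<in>{1..m}. g i z - h i z \<ge> 0}"

definition restricted_feasible ::
  "nat \<Rightarrow> (nat \<Rightarrow> real ^ 'd \<Rightarrow> real) \<Rightarrow> (nat \<Rightarrow> real ^ 'd \<Rightarrow> real) \<Rightarrow> real ^ 'd \<Rightarrow> (real ^ 'd) set" where
  "restricted_feasible m g h c = {z. \<forall>i\<in>{1..m}. linearization (g i) c z - h i z \<ge> 0}"

definition restricted_slater ::
  "nat \<Rightarrow> (nat \<Rightarrow> real ^ 'd \<Rightarrow> real) \<Rightarrow> (nat \<Rightarrow> real ^ 'd \<Rightarrow> real) \<Rightarrow> real ^ 'd \<Rightarrow> bool" where
  "restricted_slater m g h c \<longleftrightarrow> (\<exists>z. \<forall>i\<in>{1..m}. linearization (g i) c z - h i z > 0)"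

definition restricted_optimal ::
  "nat \<Rightarrow> (nat \<Rightarrow> real ^ 'd \<Rightarrow> real) \<Rightarrow> (nat \<Rightarrow> real ^ 'd \<Rightarrow> real) \<Rightarrow> real ^ 'd \<Rightarrow> real ^ 'd \<Rightarrow> bool" where
  "restricted_optimal m g h c x \<longleftrightarrow>
     x \<in> restricted_feasible m g h c \<and>
     (\<forall>z\<in>restricted_feasible m g h c.
        linearization (g 0) c z - h 0 z \<le> linearization (g 0) c x - h 0 x)"

definition critical_point ::
  "nat \<Rightarrow> (nat \<Rightarrow> real ^ 'd \<Rightarrow> real) \<Rightarrow> (nat \<Rightarrow> real ^ 'd \<Rightarrow> real) \<Rightarrow> real ^ 'd \<Rightarrow> bool" where
  "critical_point m g h c \<longleftrightarrow>
     (\<exists>\<mu> :: nat \<Rightarrow> real.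
        gradient (g 0) c + (\<Sum>i=1..m. \<mu> i *\<^sub>R gradient (g i) c) =
        gradient (h 0) c + (\<Sum>i=1..m. \<mu> i *\<^sub>R gradient (h i) c) \<and>
        (\<forall>i\<in>{1..m}. g i c \<ge> h i c \<and> \<mu> i \<ge> 0 \<and> \<mu> i * g i c = \<mu> i * h i c))"

end

theory Submission
  imports Defs
begin

text \<open>
  Only the linearized objective and constraints
  \<open>p\<^sub>i(z) = linearization (g i) c z - h i z\<close> matter. They are concave, and linearizing changes
  neither the value nor the gradient of \<open>g i\<close> at \<open>c\<close>, so the Karush-Kuhn-Tucker system of the
  restricted problem at \<open>c\<close> is literally that of the original problem. What has to be shown is
  therefore the necessity of the Karush-Kuhn-Tucker conditions for a concave program under the
  Slater condition (\<open>kkt_of_slater\<close>).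

  If some direction had positive inner product with the gradient of the objective and with the
  gradients of all active constraints, then a short step from \<open>c\<close> in that direction would stay
  feasible and improve the objective. As \<open>c\<close> is optimal, no such direction exists, and Gordan's
  theorem of the alternative (\<open>gordan_alternative\<close>), an instance of hyperplane separation, yields
  a vanishing convex combination of these gradients. The weight of the objective gradient cannot
  be zero: by the gradient inequality for concave functions, the direction from \<open>c\<close> to the Slater
  point has positive inner product with every active constraint gradient. Dividing by that weight
  gives the multipliers.
\<close>

section \<open>Gradients along lines and tangent bounds\<close>

lemma GDERIV_along_line:
  assumes "GDERIV f x :> D"
  shows "((\<lambda>t. f (x + t *\<^sub>R d)) has_real_derivative d \<bullet> D) (at 0)"
proof -
  have f: "(f has_derivative (\<lambda>e. e \<bullet> D)) (at (x + 0 *\<^sub>R d))"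
    using assms by (simp add: gderiv_def)
  have line: "((\<lambda>t::real. x + t *\<^sub>R d) has_derivative (\<lambda>t. t *\<^sub>R d)) (at 0)"
    by (auto intro!: derivative_eq_intros)
  show ?thesis
    using has_derivative_compose[OF line f]
    by (simp add: has_field_derivative_def mult.commute[of _ "d \<bullet> D"])
qed

lemma convex_on_ge_tangent_GDERIV:
  fixes f :: "'a::real_inner \<Rightarrow> real"
  assumes "convex_on UNIV f" and "GDERIV f x :> D"
  shows "f x + (z - x) \<bullet> D \<le> f z"
proof -
  let ?\<phi> = "\<lambda>t::real. f (x + t *\<^sub>R (z - x))"
  have "convex_on UNIV ?\<phi>"
  proof (rule convex_onI)
    fix t s r :: real
    assume t: "0 < t" "t < 1"
    have "x + ((1 - t) *\<^sub>R s + t *\<^sub>R r) *\<^sub>R (z - x)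
        = (1 - t) *\<^sub>R (x + s *\<^sub>R (z - x)) + t *\<^sub>R (x + r *\<^sub>R (z - x))"
      by (simp add: algebra_simps)
    then show "?\<phi> ((1 - t) *\<^sub>R s + t *\<^sub>R r) \<le> (1 - t) * ?\<phi> s + t * ?\<phi> r"
      using convex_onD[OF assms(1), of t] t by simp
  qed simp
  moreover have "(?\<phi> has_real_derivative (z - x) \<bullet> D) (at 0)"
    by (rule GDERIV_along_line[OF assms(2)])
  ultimately have "?\<phi> 1 - ?\<phi> 0 \<ge> ((z - x) \<bullet> D) * (1 - 0)"
    by (intro convex_on_imp_above_tangent[where A = UNIV]) auto
  then show ?thesis
    by simp
qed

lemma concave_on_le_tangent_GDERIV:
  fixes f :: "'a::real_inner \<Rightarrow> real"
  assumes "concave_on UNIV f" and "GDERIV f x :> D"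
  shows "f z \<le> f x + (z - x) \<bullet> D"
  using convex_on_ge_tangent_GDERIV[of "\<lambda>z. - f z" x "- D" z] assms
  by (simp add: concave_on_def GDERIV_minus)

lemma eventually_ascent:
  assumes "GDERIV f x :> D" and "0 < d \<bullet> D"
  shows "\<forall>\<^sub>F t in at_right 0. f x < f (x + t *\<^sub>R d)"
  using DERIV_pos_inc_right[OF GDERIV_along_line[OF assms(1)] assms(2)]
  by (auto simp: eventually_at_right_field)

lemma eventually_pos_along_line:
  assumes "GDERIV f x :> D" and "0 < f x"
  shows "\<forall>\<^sub>F t in at_right 0. 0 < f (x + t *\<^sub>R d)"
proof -
  have "((\<lambda>t. f (x + t *\<^sub>R d)) \<longlongrightarrow> f (x + 0 *\<^sub>R d)) (at 0)"
    using DERIV_isCont[OF GDERIV_along_line[OF assms(1), of d]] by (simp add: isCont_def)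
  then have "((\<lambda>t. f (x + t *\<^sub>R d)) \<longlongrightarrow> f x) (at_right 0)"
    by (simp add: filterlim_at_split)
  then show ?thesis
    using assms(2) by (rule order_tendstoD(1))
qed

section \<open>Karush-Kuhn-Tucker conditions for concave programs\<close>

text \<open>If zero lay outside the convex hull of the vectors, the normal of a hyperplane strictly
  separating zero from this compact set would have positive inner product with all of them.\<close>

lemma gordan_alternative:
  fixes v :: "'i \<Rightarrow> 'a::euclidean_space"
  assumes "finite I" and no_dir: "\<nexists>d. \<forall>i\<in>I. 0 < d \<bullet> v i"
  obtains w where "\<And>i. i \<in> I \<Longrightarrow> 0 \<le> w i" "sum w I = 1" "(\<Sum>i\<in>I. w i *\<^sub>R v i) = 0"
proof -
  \<comment> \<open>The convex hull, parametrized by the indices because \<open>v\<close> may take a value twice.\<close>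
  define C where "C = {\<Sum>i\<in>I. w i *\<^sub>R v i | w. (\<forall>i\<in>I. (0::real) \<le> w i) \<and> sum w I = 1}"
  have "convex C"
  proof (rule convexI)
    fix x y and s t :: real
    assume "x \<in> C" "y \<in> C" and st: "0 \<le> s" "0 \<le> t" "s + t = 1"
    then obtain a b where
        a: "\<And>i. i \<in> I \<Longrightarrow> 0 \<le> a i" "sum a I = 1" "x = (\<Sum>i\<in>I. a i *\<^sub>R v i)" and
        b: "\<And>i. i \<in> I \<Longrightarrow> 0 \<le> b i" "sum b I = 1" "y = (\<Sum>i\<in>I. b i *\<^sub>R v i)"
      unfolding C_def by blast
    let ?w = "\<lambda>i. s * a i + t * b i"
    have "s *\<^sub>R x + t *\<^sub>R y = (\<Sum>i\<in>I. ?w i *\<^sub>R v i)"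
      by (simp add: a b scaleR_sum_right sum.distrib scaleR_add_left)
    moreover have "sum ?w I = 1"
      using a b st by (simp add: sum.distrib flip: sum_distrib_left)
    moreover have "\<forall>i\<in>I. 0 \<le> ?w i"
      using a b st by simp
    ultimately show "s *\<^sub>R x + t *\<^sub>R y \<in> C"
      unfolding C_def by (intro CollectI exI[of _ ?w]) simp
  qed
  moreover have "v ` I \<subseteq> C"
  proof
    fix x assume "x \<in> v ` I"
    then obtain k where k: "k \<in> I" "x = v k"
      by blast
    let ?w = "\<lambda>i. if i = k then 1 else 0::real"
    have "x = (\<Sum>i\<in>I. ?w i *\<^sub>R v i)"
      using k \<open>finite I\<close> by (simp add: if_distrib[of "\<lambda>c. c *\<^sub>R _"] cong: if_cong)
    moreover have "sum ?w I = 1" "\<forall>i\<in>I. 0 \<le> ?w i"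
      using k \<open>finite I\<close> by auto
    ultimately show "x \<in> C"
      unfolding C_def by (intro CollectI exI[of _ ?w]) simp
  qed
  ultimately have hull: "convex hull (v ` I) \<subseteq> C"
    by (simp add: hull_minimal)
  have "0 \<in> convex hull (v ` I)"
  proof (rule ccontr)
    assume "0 \<notin> convex hull (v ` I)"
    moreover have "closed (convex hull (v ` I))"
      using \<open>finite I\<close>
      by (simp add: compact_imp_closed compact_convex_hull finite_imp_compact)
    ultimately obtain d b where "d \<bullet> 0 < b" and "\<forall>x\<in>convex hull (v ` I). d \<bullet> x > b"
      using separating_hyperplane_closed_point[of "convex hull (v ` I)" 0] by auto
    then have "\<forall>i\<in>I. 0 < d \<bullet> v i"
      by (force intro: hull_inc)
    with no_dir show False
      by blast
  qed
  with hull have "0 \<in> C"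
    by blast
  then show ?thesis
    unfolding C_def using that by force
qed

text \<open>Inactive constraints remain positive near \<open>c\<close> by continuity; hence only the active ones
  restrict the directions in which a short step is feasible.\<close>

lemma no_common_ascent_direction:
  fixes p :: "'i \<Rightarrow> 'a::real_inner \<Rightarrow> real"
  assumes "finite I"
    and f: "GDERIV f c :> u"
    and p: "\<And>i. i \<in> I \<Longrightarrow> GDERIV (p i) c :> v i"
    and feas: "\<And>i. i \<in> I \<Longrightarrow> 0 \<le> p i c"
    and opt: "\<And>z. (\<forall>i\<in>I. 0 \<le> p i z) \<Longrightarrow> f z \<le> f c"
    and d: "\<And>i. i \<in> I \<Longrightarrow> p i c = 0 \<Longrightarrow> 0 < d \<bullet> v i"
  shows "d \<bullet> u \<le> 0"
proof (rule ccontr)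
  assume "\<not> d \<bullet> u \<le> 0"
  then have "\<forall>\<^sub>F t in at_right 0. f c < f (c + t *\<^sub>R d)"
    by (intro eventually_ascent[OF f]) simp
  moreover have "\<forall>\<^sub>F t in at_right 0. 0 < p i (c + t *\<^sub>R d)" if "i \<in> I" for i
  proof (cases "p i c = 0")
    case True
    with eventually_ascent[OF p d] that show ?thesis
      by fastforce
  next
    case False
    with feas that show ?thesis
      by (intro eventually_pos_along_line[OF p]) (auto simp: less_le)
  qed
  then have "\<forall>\<^sub>F t in at_right 0. \<forall>i\<in>I. 0 < p i (c + t *\<^sub>R d)"
    using \<open>finite I\<close> by (simp add: eventually_ball_finite)
  ultimately have "\<forall>\<^sub>F t in at_right 0.
      f c < f (c + t *\<^sub>R d) \<and> (\<forall>i\<in>I. 0 < p i (c + t *\<^sub>R d))"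
    by (rule eventually_conj)
  then obtain t :: real where "f c < f (c + t *\<^sub>R d)" "\<forall>i\<in>I. 0 < p i (c + t *\<^sub>R d)"
    using eventually_happens[of _ "at_right (0::real)"] by auto
  with opt[of "c + t *\<^sub>R d"] show False
    by force
qed

text \<open>Without the Slater point, Gordan's theorem would only give multipliers in which the objective
  may have weight zero (the Fritz John conditions).\<close>

lemma kkt_of_slater:
  fixes p :: "'i \<Rightarrow> 'a::euclidean_space \<Rightarrow> real"
  assumes "finite I"
    and f: "GDERIV f c :> u"
    and p: "\<And>i. i \<in> I \<Longrightarrow> GDERIV (p i) c :> v i"
    and conc: "\<And>i. i \<in> I \<Longrightarrow> concave_on UNIV (p i)"
    and slater: "\<And>i. i \<in> I \<Longrightarrow> 0 < p i zbar"
    and feas: "\<And>i. i \<in> I \<Longrightarrow> 0 \<le> p i c"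
    and opt: "\<And>z. (\<forall>i\<in>I. 0 \<le> p i z) \<Longrightarrow> f z \<le> f c"
  obtains \<mu> where "u + (\<Sum>i\<in>I. \<mu> i *\<^sub>R v i) = 0"
    and "\<And>i. i \<in> I \<Longrightarrow> 0 \<le> \<mu> i" and "\<And>i. i \<in> I \<Longrightarrow> \<mu> i * p i c = 0"
proof -
  define A where "A = {i \<in> I. p i c = 0}"
  have "finite A"
    using \<open>finite I\<close> by (simp add: A_def)
  \<comment> \<open>The index \<open>None\<close> stands for the objective, \<open>Some i\<close> for the active constraint \<open>i\<close>.\<close>
  define V where "V = case_option u v"
  let ?J = "insert None (Some ` A)"
  have "\<nexists>d. \<forall>j\<in>?J. 0 < d \<bullet> V j"
  proof
    assume "\<exists>d. \<forall>j\<in>?J. 0 < d \<bullet> V j"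
    then obtain d where d: "\<And>j. j \<in> ?J \<Longrightarrow> 0 < d \<bullet> V j"
      by blast
    have active: "0 < d \<bullet> v i" if "i \<in> I" "p i c = 0" for i
      using d[of "Some i"] that by (simp add: V_def A_def)
    have "d \<bullet> u \<le> 0"
      by (rule no_common_ascent_direction[of I f c u p v, OF \<open>finite I\<close> f p feas opt active])
    with d[of None] show False
      by (simp add: V_def)
  qed
  with \<open>finite A\<close> obtain w where w_nonneg: "\<And>j. j \<in> ?J \<Longrightarrow> 0 \<le> w j"
      and w_sum: "sum w ?J = 1" and w_zero: "(\<Sum>j\<in>?J. w j *\<^sub>R V j) = 0"
    using gordan_alternative[of ?J V] by blast
  define \<kappa> where "\<kappa> = w None"
  define a where "a i = w (Some i)" for i
  have a_nonneg: "0 \<le> a i" if "i \<in> A" for i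
    using w_nonneg that by (simp add: a_def)
  have total: "\<kappa> + sum a A = 1"
    using w_sum \<open>finite A\<close> by (simp add: \<kappa>_def a_def sum.reindex)
  have comb: "\<kappa> *\<^sub>R u + (\<Sum>i\<in>A. a i *\<^sub>R v i) = 0"
    using w_zero \<open>finite A\<close> by (simp add: \<kappa>_def a_def V_def sum.reindex)
  have "\<kappa> \<noteq> 0"
  proof
    assume "\<kappa> = 0"
    have pos: "0 < (zbar - c) \<bullet> v i" if "i \<in> A" for i
      using concave_on_le_tangent_GDERIV[OF conc p, of i zbar] slater[of i] that
      by (simp add: A_def)
    have "(zbar - c) \<bullet> (\<Sum>i\<in>A. a i *\<^sub>R v i) = 0"
      using comb \<open>\<kappa> = 0\<close> by simp
    then have "(\<Sum>i\<in>A. a i * ((zbar - c) \<bullet> v i)) = 0"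
      by (simp add: inner_sum_right)
    then have "\<forall>i\<in>A. a i * ((zbar - c) \<bullet> v i) = 0"
      using \<open>finite A\<close> a_nonneg pos
      by (subst (asm) sum_nonneg_eq_0_iff) (simp_all add: less_imp_le)
    then have "\<forall>i\<in>A. a i = 0"
      using pos by fastforce
    with total \<open>\<kappa> = 0\<close> show False
      by simp
  qed
  then have "0 < \<kappa>"
    using w_nonneg[of None] by (simp add: \<kappa>_def)
  define \<mu> where "\<mu> i = (if i \<in> A then a i / \<kappa> else 0)" for i
  have "(\<Sum>i\<in>I. \<mu> i *\<^sub>R v i) = (\<Sum>i\<in>A. \<mu> i *\<^sub>R v i)"
    using \<open>finite I\<close> by (intro sum.mono_neutral_right) (auto simp: A_def \<mu>_def)
  also have "\<dots> = (1 / \<kappa>) *\<^sub>R (\<Sum>i\<in>A. a i *\<^sub>R v i)"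
    by (simp add: \<mu>_def scaleR_sum_right)
  finally have "u + (\<Sum>i\<in>I. \<mu> i *\<^sub>R v i)
      = (1 / \<kappa>) *\<^sub>R (\<kappa> *\<^sub>R u + (\<Sum>i\<in>A. a i *\<^sub>R v i))"
    using \<open>0 < \<kappa>\<close> by (simp add: scaleR_add_right)
  then have "u + (\<Sum>i\<in>I. \<mu> i *\<^sub>R v i) = 0"
    by (simp add: comb)
  moreover have "0 \<le> \<mu> i" for i
    using a_nonneg \<open>0 < \<kappa>\<close> by (simp add: \<mu>_def)
  moreover have "\<mu> i * p i c = 0" for i
    by (simp add: \<mu>_def A_def)
  ultimately show ?thesis
    using that by blast
qed

section \<open>The restricted problem\<close>

lemma quadratic_function_GDERIV:
  assumes "quadratic_function f"
  shows "GDERIV f x :> gradient f x"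
proof -
  obtain A b r where A: "transpose A = A" and f: "\<And>z. f z = z \<bullet> (A *v z) + b \<bullet> z + r"
    using assms unfolding quadratic_function_def by blast
  have "x \<bullet> (A *v e) = e \<bullet> (A *v x)" for e
    by (metis A dot_lmul_matrix inner_commute transpose_matrix_vector)
  then have "GDERIV (\<lambda>z. z \<bullet> (A *v z) + b \<bullet> z + r) x :> 2 *\<^sub>R (A *v x) + b"
    unfolding gderiv_def
    by (auto intro!: derivative_eq_intros bounded_linear_imp_has_derivative
        simp: inner_add_right inner_commute[of b])
  then have "GDERIV f x :> 2 *\<^sub>R (A *v x) + b"
    by (simp flip: f)
  then show ?thesis
    by (simp add: gradient_eqI)
qed

lemma GDERIV_linearization: "GDERIV (linearization f c) x :> gradient f c"
  unfolding gderiv_def linearization_def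
  by (auto intro!: derivative_eq_intros simp: inner_commute)

lemma concave_on_linearization:
  fixes f :: "real ^ 'd \<Rightarrow> real"
  shows "concave_on UNIV (linearization f c)"
  unfolding concave_on_iff linearization_def
proof (clarsimp)
  fix x y :: "real ^ 'd" and s t :: real
  assume "s + t = 1"
  then have t: "t = 1 - s"
    by simp
  show "s * (f c + gradient f c \<bullet> (x - c)) + t * (f c + gradient f c \<bullet> (y - c))
      \<le> f c + gradient f c \<bullet> (s *\<^sub>R x + t *\<^sub>R y - c)"
    by (simp add: t algebra_simps inner_diff_right inner_add_right)
qed

theorem proposition3:
  fixes g h :: "nat \<Rightarrow> real ^ 'd \<Rightarrow> real" and m :: nat and c :: "real ^ 'd"
  assumes "\<And>i. i \<le> m \<Longrightarrow> convex_quadratic (g i)"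
    and "\<And>i. i \<le> m \<Longrightarrow> convex_quadratic (h i)"
    and "c \<in> dco_feasible m g h"
    and "restricted_slater m g h c"
    and "restricted_optimal m g h c c"
  shows "critical_point m g h c"
proof -
  define p where "p i z = linearization (g i) c z - h i z" for i z
  define v where "v i = gradient (g i) c - gradient (h i) c" for i
  have deriv: "GDERIV (p i) c :> v i" if "i \<le> m" for i
    unfolding p_def v_def using assms(2)[OF that]
    by (intro GDERIV_diff GDERIV_linearization quadratic_function_GDERIV)
      (simp add: convex_quadratic_def)
  have conc: "concave_on UNIV (p i)" if "i \<le> m" for i
    unfolding p_def using assms(2)[OF that]
    by (intro concave_on_diff concave_on_linearization) (simp add: convex_quadratic_def)
  have value_at_c: "p i c = g i c - h i c" for i
    by (simp add: p_def linearization_def)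
  have feas: "h i c \<le> g i c" if "i \<in> {1..m}" for i
    using assms(3) that by (simp add: dco_feasible_def)
  obtain zbar where slater: "\<And>i. i \<in> {1..m} \<Longrightarrow> 0 < p i zbar"
    using assms(4) unfolding restricted_slater_def p_def by blast
  have opt: "p 0 z \<le> p 0 c" if "\<forall>i\<in>{1..m}. 0 \<le> p i z" for z
    using assms(5) that by (simp add: restricted_optimal_def restricted_feasible_def p_def)
  obtain \<mu> where stat: "v 0 + (\<Sum>i=1..m. \<mu> i *\<^sub>R v i) = 0"
      and nonneg: "\<And>i. i \<in> {1..m} \<Longrightarrow> 0 \<le> \<mu> i"
      and compl: "\<And>i. i \<in> {1..m} \<Longrightarrow> \<mu> i * p i c = 0"
    by (rule kkt_of_slater[of "{1..m}" "p 0" c "v 0" p v zbar])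
      (use deriv conc slater feas opt value_at_c in auto)
  have "gradient (g 0) c + (\<Sum>i=1..m. \<mu> i *\<^sub>R gradient (g i) c)
      = gradient (h 0) c + (\<Sum>i=1..m. \<mu> i *\<^sub>R gradient (h i) c)"
    using stat by (simp add: v_def scaleR_diff_right sum_subtractf algebra_simps)
  moreover have "\<mu> i * g i c = \<mu> i * h i c" if "i \<in> {1..m}" for i
    using compl[OF that] by (simp add: value_at_c algebra_simps)
  ultimately show ?thesis
    unfolding critical_point_def using feas nonneg by blast
qed

end
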